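(* For any integers $k>l\ge 2$, as $n\to\infty$, $$ex(n,C_{2l+1},\{C_3,C_4,\dots,C_{2l}\}\cup\{C_{2k+1}\})=\Omega(n^{1+\frac{1}{2k+2}})\quad\text{and}\quad ex(n,C_{2l+1},\{C_3,C_4,\dots,C_{2l}\}\cup\{C_{2k+1}\})=O(n^{2}).$$
   Context: $C_k$ denotes the cycle with $k$ vertices. For a graph $H$ and a family of graphs $\mathcal F$, $ex(n,H,\mathcal F)$ is the maximum number of subgraphs isomorphic to $H$ in an $n$-vertex graph containing no member of $\mathcal F$ as a subgraph. *)

theory Defs
  imports Complex_Main "HOL-Library.Landau_Symbols"
begin

definition simple_graph :: "nat \<Rightarrow> nat set set \<Rightarrow> bool" where
  "simple_graph n E \<longleftrightarrow> E \<subseteq> {{u, v} | u v. u < n \<and> v < n \<and> u \<noteq> v}"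

definition cycle_edges :: "nat \<Rightarrow> (nat \<Rightarrow> nat) \<Rightarrow> nat set set" where
  "cycle_edges k vs = {{vs i, vs ((i + 1) mod k)} | i. i < k}"

text \<open>C is (the edge set of) a subgraph of E isomorphic to the cycle C_k.
  Since a cycle has no isolated vertices, such a subgraph is determined by its edge set.\<close>
definition is_cycle_in :: "nat set set \<Rightarrow> nat \<Rightarrow> nat set set \<Rightarrow> bool" where
  "is_cycle_in E k C \<longleftrightarrow> 3 \<le> k \<and> C \<subseteq> E \<and>
     (\<exists>vs. inj_on vs {..<k} \<and> C = cycle_edges k vs)"

definition contains_cycle :: "nat set set \<Rightarrow> nat \<Rightarrow> bool" where
  "contains_cycle E k \<longleftrightarrow> (\<exists>C. is_cycle_in E k C)"

definition count_cycles :: "nat set set \<Rightarrow> nat \<Rightarrow> nat" where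
  "count_cycles E k = card {C. is_cycle_in E k C}"

definition ex_cycles :: "nat \<Rightarrow> nat \<Rightarrow> nat set \<Rightarrow> nat" where
  "ex_cycles n h F = Max {count_cycles E h | E. simple_graph n E \<and>
      (\<forall>k\<in>F. \<not> contains_cycle E k)}"

end

theory Submission
  imports Defs
begin

text \<open>Upper bound: if the girth exceeds \<open>2l\<close>, paths with \<open>l\<close> edges are determined by their ends, so
  a \<open>(2l+1)\<close>-cycle is determined by one of its vertices \<open>w\<close> and the edge opposite to it. For fixed \<open>w\<close>
  the opposite edges form a graph on vertices at distance \<open>l\<close> from \<open>w\<close>, properly coloured by the
  branch at \<open>w\<close> containing a vertex. If it had more than a constant times \<open>n\<close> edges, a subgraph of
  large minimum degree would contain a path with \<open>2k+1-2l\<close> edges between different branches, which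
  closes up through \<open>w\<close> to a \<open>(2k+1)\<close>-cycle.

  Lower bound: in a graph of maximum degree \<open>D\<close>, greedily add \<open>(2l+1)\<close>-cycles on vertices of
  non-maximal degree that are pairwise at distance more than \<open>2k+1\<close>; no other short cycles arise. This
  only stops when all but \<open>O(D^(2k+1))\<close> vertices have degree at least \<open>D - 1\<close>, so \<open>D\<close> can be taken
  of order \<open>n^(1/(2k+2))\<close>.\<close>

section \<open>Upper bound\<close>

text \<open>Paths are vertex lists, so \<open>length p\<close> is one more than the number of edges;
  a single vertex is a path.\<close>

definition is_path :: "nat set set \<Rightarrow> nat list \<Rightarrow> bool" where
  "is_path E p \<longleftrightarrow> p \<noteq> [] \<and> distinct p \<and> successively (\<lambda>x y. {x, y} \<in> E) p"

lemma contains_cycle_if_closed_path: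
  assumes "is_path E p" "{last p, hd p} \<in> E" "3 \<le> length p"
  shows "contains_cycle E (length p)"
proof -
  have "{p ! i, p ! ((i + 1) mod length p)} \<in> E" if "i < length p" for i
  proof (cases "i + 1 < length p")
    case True
    then show ?thesis
      using assms(1) by (simp add: is_path_def successively_conv_nth)
  next
    case False
    then have "i = length p - 1" "i + 1 = length p" using that by auto
    then show ?thesis
      using assms(1,2) by (simp add: is_path_def last_conv_nth hd_conv_nth)
  qed
  then have "cycle_edges (length p) ((!) p) \<subseteq> E"
    by (auto simp: cycle_edges_def)
  moreover have "inj_on ((!) p) {..<length p}"
    using assms(1) by (auto simp: is_path_def inj_on_nth)
  ultimately show ?thesis
    using assms(3) unfolding contains_cycle_def is_cycle_in_def by blast
qed

lemma successively_join:
  "successively P (xs @ [x]) \<Longrightarrow> successively P (x # ys) \<Longrightarrow> successively P (xs @ x # ys)"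
  by (simp add: successively_append_iff)

text \<open>Common first edges are stripped off by induction. Where the paths diverge, following
  both to a first common vertex closes a cycle with at most \<open>length p + length q - 2\<close>
  vertices, hence at most \<open>g\<close>.\<close>

lemma path_unique:
  assumes girth: "\<And>j. j \<in> {3..g} \<Longrightarrow> \<not> contains_cycle E j"
    and "is_path E p" "is_path E q" "hd p = hd q" "last p = last q"
    and "length p + length q \<le> g + 2"
  shows "p = q"
  using assms(2-)
proof (induction p arbitrary: q)
  case Nil
  then show ?case by (simp add: is_path_def)
next
  case (Cons a p')
  then obtain q' where q: "q = a # q'"
    by (cases q) (auto simp: is_path_def)
  show ?case
  proof (cases "p' = [] \<or> q' = []")
    case True
    then show ?thesis
      using Cons.prems q by (auto simp: is_path_def split: if_splits)
  next
    case False
    then have ne: "p' \<noteq> []" "q' \<noteq> []" by auto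
    have ip: "is_path E p'" "is_path E q'" "{a, hd p'} \<in> E" "{a, hd q'} \<in> E" "a \<notin> set p'" "a \<notin> set q'"
      using Cons.prems q ne by (auto simp: is_path_def successively_Cons)
    have last: "last p' = last q'" using Cons.prems q ne by auto
    show ?thesis
    proof (cases "hd p' = hd q'")
      case True
      then show ?thesis using Cons.IH[of q'] Cons.prems ip last q by auto
    next
      case hd: False
      have "\<exists>x\<in>set p'. x \<in> set q'" using last ne by (metis last_in_set)
      \<comment> \<open>Taking the first vertex of \<open>p'\<close> on \<open>q'\<close> keeps
        \<open>p1\<close> disjoint from \<open>q'\<close>, so the closed walk \<open>?c\<close>
        repeats no vertex.\<close>
      then obtain p1 x p2 where p': "p' = p1 @ x # p2" "x \<in> set q'" "\<forall>y\<in>set p1. y \<notin> set q'"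
        using split_list_first_prop[of p' "\<lambda>x. x \<in> set q'"] by metis
      then obtain q1 q2 where q': "q' = q1 @ x # q2" by (meson split_list)
      let ?c = "a # p1 @ x # rev q1"
      have q1: "successively (\<lambda>x y. {x, y} \<in> E) (x # rev q1)"
      proof -
        have "successively (\<lambda>x y. {x, y} \<in> E) (q1 @ [x])"
          using ip(2) unfolding q' is_path_def by (simp add: successively_append_iff)
        then have "successively (\<lambda>x y. {y, x} \<in> E) (rev (q1 @ [x]))"
          by (subst successively_rev) simp
        then show ?thesis by (simp add: insert_commute)
      qed
      have "successively (\<lambda>x y. {x, y} \<in> E) (p1 @ [x])" "{a, hd (p1 @ [x])} \<in> E"
        using ip(1,3) unfolding p'(1) is_path_def
        by (simp_all add: successively_append_iff hd_append split: if_splits)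
      then have "successively (\<lambda>x y. {x, y} \<in> E) ((a # p1) @ [x])"
        by (cases p1) simp_all
      with q1 have "successively (\<lambda>x y. {x, y} \<in> E) ?c"
        using successively_join[of _ "a # p1" x "rev q1"] by simp
      moreover have "distinct ?c"
        using ip(1,2,5,6) p'(3) unfolding p'(1) q' is_path_def by auto
      ultimately have "is_path E ?c" by (simp add: is_path_def)
      moreover have "{last ?c, hd ?c} \<in> E"
        using ip q' by (auto simp: last_rev hd_append insert_commute split: if_splits)
      \<comment> \<open>\<open>p1\<close> and \<open>q1\<close> are not both empty, since the paths
        leave \<open>a\<close> through different vertices.\<close>
      moreover have "3 \<le> length ?c"
        using hd p' q' by (cases p1; cases q1) auto
      ultimately have "contains_cycle E (length ?c)"
        by (rule contains_cycle_if_closed_path)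
      then show ?thesis
        using girth[of "length ?c"] \<open>3 \<le> length ?c\<close> Cons.prems(5) q p' q' by auto
    qed
  qed
qed

section \<open>Paths in graphs of large minimum degree\<close>

text \<open>A vertex with at most \<open>d\<close> neighbours in \<open>V\<close> can be deleted: at
  most \<open>d\<close> edges are lost, so the edge bound survives. Deletion must stop, because an
  empty vertex set carries no edges.\<close>

lemma exists_min_degree_subgraph:
  fixes E :: "nat set set"
  assumes "finite V" "E \<subseteq> {{u, v} | u v. u \<in> V \<and> v \<in> V \<and> u \<noteq> v}" "d * card V < card E"
  shows "\<exists>W\<subseteq>V. W \<noteq> {} \<and> (\<forall>v\<in>W. d < card {u\<in>W. {u, v} \<in> E})"
  using assms
proof (induction "card V" arbitrary: V E)
  case 0
  then show ?case by auto
next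
  case (Suc m)
  show ?case
  proof (cases "\<forall>v\<in>V. d < card {u\<in>V. {u, v} \<in> E}")
    case True
    then show ?thesis using Suc.hyps(2) by (intro exI[of _ V]) auto
  next
    case False
    then obtain v where v: "v \<in> V" "card {u\<in>V. {u, v} \<in> E} \<le> d" by force
    let ?V = "V - {v}" and ?E = "{e\<in>E. v \<notin> e}" and ?S = "{e\<in>E. v \<in> e}"
    have "?S \<subseteq> (\<lambda>u. {u, v}) ` {u\<in>V. {u, v} \<in> E}"
    proof
      fix e assume e: "e \<in> ?S"
      then obtain a b where ab: "e = {a, b}" "a \<in> V" "b \<in> V" using Suc.prems(2) by blast
      then have "v = a \<or> v = b" using e by simp
      then have "e = {b, v} \<or> e = {a, v}" using ab(1) by (auto simp: insert_commute)
      then show "e \<in> (\<lambda>u. {u, v}) ` {u\<in>V. {u, v} \<in> E}"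
        using e ab(2,3) by (elim disjE) auto
    qed
    then have "card ?S \<le> card {u\<in>V. {u, v} \<in> E}"
      using Suc.prems(1) by (intro surj_card_le) auto
    then have S: "card ?S \<le> d" using v by linarith
    have "E = ?E \<union> ?S" by auto
    then have "card E \<le> card ?E + card ?S"
      using card_Un_le[of ?E ?S] by simp
    moreover have "card V = Suc (card ?V)" using v Suc.prems(1) by (metis card_Suc_Diff1)
    ultimately have "d * card ?V < card ?E" using S Suc.prems(3) by auto
    moreover have "?E \<subseteq> {{u, w} | u w. u \<in> ?V \<and> w \<in> ?V \<and> u \<noteq> w}"
    proof
      fix e assume e: "e \<in> ?E"
      then obtain a b where "e = {a, b}" "a \<in> V" "b \<in> V" "a \<noteq> b" using Suc.prems(2) by blast
      then show "e \<in> {{u, w} | u w. u \<in> ?V \<and> w \<in> ?V \<and> u \<noteq> w}" using e by blast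
    qed
    ultimately obtain W where W: "W \<subseteq> ?V" "W \<noteq> {}" "\<forall>v\<in>W. d < card {u\<in>W. {u, v} \<in> ?E}"
      using Suc.hyps(1)[of ?V ?E] \<open>card V = Suc (card ?V)\<close> Suc.hyps(2) Suc.prems(1) by auto
    have "d < card {u\<in>W. {u, x} \<in> E}" if "x \<in> W" for x
    proof -
      have "finite W" using W(1) Suc.prems(1) by (meson finite_Diff finite_subset)
      then have "card {u\<in>W. {u, x} \<in> ?E} \<le> card {u\<in>W. {u, x} \<in> E}"
        by (intro card_mono) auto
      then show ?thesis using W(3) that by fastforce
    qed
    then show ?thesis using W by blast
  qed
qed

text \<open>Greedy extension: the last vertex has more than \<open>d\<close> neighbours in
  \<open>W\<close>, while \<open>A\<close> and the vertices used so far number at most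
  \<open>d\<close>.\<close>

lemma exists_path_avoiding:
  assumes deg: "\<And>v. v \<in> W \<Longrightarrow> d < card {u\<in>W. {u, v} \<in> H}"
    and "v \<in> W" "finite A" "v \<notin> A" "card A + j \<le> d"
  shows "\<exists>p. is_path H p \<and> hd p = v \<and> length p = j + 1 \<and> set p \<subseteq> W - A"
  using assms(5)
proof (induction j)
  case 0
  then show ?case using assms(2,4) by (intro exI[of _ "[v]"]) (auto simp: is_path_def)
next
  case (Suc j)
  then obtain p where p: "is_path H p" "hd p = v" "length p = j + 1" "set p \<subseteq> W - A" by auto
  have "last p \<in> W" using p(1,4) last_in_set[of p] unfolding is_path_def by blast
  then have "card (A \<union> set p) < card {u\<in>W. {u, last p} \<in> H}"
    using deg[of "last p"] Suc.prems card_Un_le[of A "set p"] card_length[of p] p(3) by linarith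
  then have "\<not> {u\<in>W. {u, last p} \<in> H} \<subseteq> A \<union> set p"
    by (meson assms(3) List.finite_set card_mono finite_UnI not_less)
  then obtain u where "u \<in> W" "{u, last p} \<in> H" "u \<notin> A" "u \<notin> set p" by auto
  then show ?case
    using p by (intro exI[of _ "p @ [u]"]) (auto simp: is_path_def successively_append_iff insert_commute)
qed

text \<open>If the endpoints of all paths with \<open>m\<close> edges had equal colours, then rerouting a path through
  another neighbour of its second vertex shows that all neighbours of a vertex share their colour;
  colours then alternate along paths, which is impossible for odd \<open>m\<close>.\<close>
lemma exists_path_with_differently_coloured_ends:
  assumes deg: "\<And>v. v \<in> W \<Longrightarrow> m + 2 < card {u\<in>W. {u, v} \<in> H}"
    and "W \<noteq> {}" and proper: "\<And>x y. {x, y} \<in> H \<Longrightarrow> c x \<noteq> c y" and "odd m"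
  shows "\<exists>p. is_path H p \<and> length p = m + 1 \<and> c (hd p) \<noteq> c (last p)"
proof (rule ccontr)
  assume "\<not> ?thesis"
  then have same: "c (hd p) = c (last p)" if "is_path H p" "length p = m + 1" for p
    using that by blast
  have m: "m \<ge> 1" using \<open>odd m\<close> by (cases m) auto
  have nb: "c y = c z" if "v \<in> W" "{y, v} \<in> H" "{z, v} \<in> H" for v y z
  proof -
    have "v \<notin> {y, z}" using that proper by blast
    moreover have "card {y, z} + (m - 1) \<le> m + 2"
      using card_insert_le_m1[of 2 "{z}" y] by auto
    \<comment> \<open>This path has \<open>m - 1\<close> edges and avoids both \<open>y\<close> and
      \<open>z\<close>, so either of them can be put in front of it to give \<open>m\<close>
      edges.\<close>
    ultimately obtain p where p: "is_path H p" "hd p = v" "length p = m - 1 + 1" "set p \<subseteq> W - {y, z}"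
      using exists_path_avoiding[of W "m + 2" H v "{y, z}" "m - 1"] deg \<open>v \<in> W\<close> by auto
    have "c x = c (last p)" if "x \<in> {y, z}" for x
      using same[of "x # p"] p m that \<open>{y, v} \<in> H\<close> \<open>{z, v} \<in> H\<close>
      by (auto simp: is_path_def successively_Cons)
    then show ?thesis by auto
  qed
  obtain v where "v \<in> W" using \<open>W \<noteq> {}\<close> by blast
  then obtain p where p: "is_path H p" "length p = m + 1" "set p \<subseteq> W"
    using exists_path_avoiding[of W "m + 2" H v "{}" m] deg by auto
  have adj: "{p ! i, p ! Suc i} \<in> H" if "i < m" for i
    using p that by (simp add: is_path_def successively_conv_nth)
  \<comment> \<open>Successive vertices of odd index are neighbours of the vertex between them, so
    they share a colour. As \<open>m\<close> is odd, this reaches the end of the path, which by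
    \<open>same\<close> also has the colour of \<open>p ! 0\<close>.\<close>
  have "2 * i + 1 \<le> m \<Longrightarrow> c (p ! (2 * i + 1)) = c (p ! 1)" for i
  proof (induction i)
    case (Suc i)
    have "p ! (2 * i + 2) \<in> W" using p Suc.prems by auto
    moreover have "{p ! (2 * i + 1), p ! (2 * i + 2)} \<in> H" "{p ! (2 * i + 2), p ! (2 * i + 3)} \<in> H"
      using adj[of "2 * i + 1"] adj[of "2 * i + 2"] Suc.prems by (auto simp: eval_nat_numeral)
    ultimately have "c (p ! (2 * i + 1)) = c (p ! (2 * i + 3))"
      using nb by (metis insert_commute)
    then show ?case using Suc by (simp add: eval_nat_numeral)
  qed auto
  then have "c (p ! m) = c (p ! 1)"
    using \<open>odd m\<close> by (metis oddE order_refl)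
  moreover have "c (p ! 0) = c (p ! m)"
    using same[OF p(1,2)] p by (auto simp: is_path_def hd_conv_nth last_conv_nth)
  ultimately show False using proper adj[of 0] m by fastforce
qed

section \<open>Geodesics from a vertex and the edges opposite to it\<close>

text \<open>Without cycles of length at most \<open>2*l\<close>, a path with \<open>l\<close> edges
  is the unique shortest one between its ends, so the choice made by \<open>SOME\<close> is then
  harmless.\<close>

definition geodesic :: "nat set set \<Rightarrow> nat \<Rightarrow> nat \<Rightarrow> nat \<Rightarrow> nat list" where
  "geodesic E l w x = (SOME p. is_path E p \<and> hd p = w \<and> last p = x \<and> length p = l + 1)"

text \<open>The entry at index 1 names the branch at \<open>w\<close> through which a path
  leaves.\<close>

definition opposite_edges :: "nat set set \<Rightarrow> nat \<Rightarrow> nat \<Rightarrow> nat set set" where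
  "opposite_edges E l w = {{x, y} | x y. {x, y} \<in> E \<and> (\<exists>p q. is_path E p \<and> is_path E q \<and>
     hd p = w \<and> hd q = w \<and> last p = x \<and> last q = y \<and> length p = l + 1 \<and> length q = l + 1 \<and> p ! 1 \<noteq> q ! 1)}"

definition path_edges :: "nat list \<Rightarrow> nat set set" where
  "path_edges p = {{p ! i, p ! (i + 1)} | i. i + 1 < length p}"

lemma geodesic_eqI:
  assumes "\<And>j. j \<in> {3..2*l} \<Longrightarrow> \<not> contains_cycle E j"
    and "is_path E p" "hd p = w" "last p = x" "length p = l + 1"
  shows "geodesic E l w x = p"
proof -
  let ?P = "\<lambda>p. is_path E p \<and> hd p = w \<and> last p = x \<and> length p = l + 1"
  have "?P (geodesic E l w x)"
    unfolding geodesic_def by (rule someI[of ?P p]) (use assms in auto)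
  then show ?thesis using path_unique[OF assms(1), where g = "2 * l" and p = "geodesic E l w x" and q = p] assms by auto
qed

text \<open>The definition only provides some pair of paths; uniqueness identifies them with the
  chosen geodesics. Hence the branch of the geodesic is a proper colouring of the graph of opposite
  edges.\<close>

lemma opposite_edgesD:
  assumes girth: "\<And>j. j \<in> {3..2*l} \<Longrightarrow> \<not> contains_cycle E j"
    and "{x, y} \<in> opposite_edges E l w"
  shows "{x, y} \<in> E" "is_path E (geodesic E l w x)" "hd (geodesic E l w x) = w"
    "last (geodesic E l w x) = x" "length (geodesic E l w x) = l + 1"
    "geodesic E l w x ! 1 \<noteq> geodesic E l w y ! 1"
proof -
  obtain p q where pq: "{x, y} \<in> E" "is_path E p" "is_path E q" "hd p = w" "hd q = w"
    "last p = x" "last q = y" "length p = l + 1" "length q = l + 1" "p ! 1 \<noteq> q ! 1"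
  proof -
    from assms(2) obtain x' y' p' q' where *: "{x, y} = {x', y'}" "{x', y'} \<in> E" "is_path E p'" "is_path E q'"
      "hd p' = w" "hd q' = w"
      "last p' = x'" "last q' = y'" "length p' = l + 1" "length q' = l + 1" "p' ! 1 \<noteq> q' ! 1"
      unfolding opposite_edges_def by auto
    \<comment> \<open>The edge is unordered, so its ends may come swapped; the two paths then
      exchange roles.\<close>
    from *(1) consider "x = x'" "y = y'" | "x = y'" "y = x'" by (auto simp: doubleton_eq_iff)
    then show thesis
      by cases (rule that[of p' q'] that[of q' p'],
          use * in \<open>simp_all add: insert_commute\<close>)+
  qed
  have "geodesic E l w x = p" "geodesic E l w y = q"
    using geodesic_eqI[OF girth] pq by blast+
  then show "{x, y} \<in> E" "is_path E (geodesic E l w x)" "hd (geodesic E l w x) = w"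
    "last (geodesic E l w x) = x" "length (geodesic E l w x) = l + 1"
    "geodesic E l w x ! 1 \<noteq> geodesic E l w y ! 1"
    using pq by auto
qed

text \<open>A path between differently coloured ends in the graph of opposite edges closes up, along the
  two geodesics from \<open>w\<close>, to a cycle: vertices of this graph have distance exactly \<open>l\<close> from \<open>w\<close>.\<close>
lemma contains_cycle_if_path_in_opposite_edges:
  assumes girth: "\<And>j. j \<in> {3..2*l} \<Longrightarrow> \<not> contains_cycle E j" and "1 \<le> l" "1 \<le> m"
    and p: "is_path (opposite_edges E l w) p" "length p = m + 1"
    and branch: "geodesic E l w (hd p) ! 1 \<noteq> geodesic E l w (last p) ! 1"
  shows "contains_cycle E (2 * l + m)"
proof -
  let ?H = "opposite_edges E l w" and ?g = "geodesic E l w"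
  \<comment> \<open>A vertex with an edge in \<open>?H\<close> has a genuine path as its
    \<open>geodesic\<close>, not an arbitrary value of \<open>SOME\<close>.\<close>
  have verts: "\<exists>z. {y, z} \<in> ?H" if y: "y \<in> set p" for y
  proof -
    obtain i where i: "i < length p" "y = p ! i" using y by (auto simp: in_set_conv_nth)
    show ?thesis
    proof (cases "Suc i < length p")
      case True
      then show ?thesis using p i by (auto simp: is_path_def successively_conv_nth)
    next
      case False
      then have "Suc (i - 1) = i" "Suc (i - 1) < length p" using i p \<open>1 \<le> m\<close> by auto
      then have "{p ! (i - 1), y} \<in> ?H"
        using p i unfolding is_path_def successively_conv_nth by metis
      then show ?thesis by (metis insert_commute)
    qed
  qed
  have geo: "is_path E (?g y)" "hd (?g y) = w" "last (?g y) = y" "length (?g y) = l + 1"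
    if "y \<in> set p" for y
    using verts[OF that] opposite_edgesD[OF girth] by blast+
  \<comment> \<open>Geodesics that meet agree up to the meeting vertex, since both initial segments
    have at most \<open>l\<close> edges. In particular the meeting vertex has the same position on
    both.\<close>
  have take_geo: "take (Suc i) (?g y) = take (Suc j) (?g z)"
    if "y \<in> set p" "z \<in> set p" "i \<le> l" "j \<le> l" "?g y ! i = ?g z ! j" for y z i j
  proof (rule path_unique[OF girth, where g = "2 * l"])
    have "is_path E (take (Suc i) (?g y)) \<and> hd (take (Suc i) (?g y)) = w \<and> last (take (Suc i) (?g y)) = ?g y ! i
        \<and> length (take (Suc i) (?g y)) = Suc i"
      if "y \<in> set p" "i \<le> l" for y i
      using geo[OF that(1)] that(2)
      by (auto simp: is_path_def successively_conv_nth last_conv_nth)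
    note * = this[OF that(1,3)] this[OF that(2,4)]
    show "is_path E (take (Suc i) (?g y))" "is_path E (take (Suc j) (?g z))"
      "hd (take (Suc i) (?g y)) = hd (take (Suc j) (?g z))"
      "last (take (Suc i) (?g y)) = last (take (Suc j) (?g z))"
      "length (take (Suc i) (?g y)) + length (take (Suc j) (?g z)) \<le> 2 * l + 2"
      using * that by auto
  qed
  have ge: "?g y ! l = y" if "y \<in> set p" for y
    using geo[OF that] by (metis add_diff_cancel_right' is_path_def last_conv_nth)
  \<comment> \<open>A vertex of \<open>p\<close> has position \<open>l\<close> on its own geodesic,
    hence on any other one through it, where position \<open>l\<close> is the end.\<close>
  have inter: "x = y" if xy: "x \<in> set p" "y \<in> set p" "x \<in> set (?g y)" for x y
  proof -
    obtain i where i: "i \<le> l" "?g y ! i = x"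
      using xy(3) geo(4)[OF xy(2)] by (metis Suc_eq_plus1 in_set_conv_nth less_Suc_eq_le)
    then have "take (Suc i) (?g y) = take (Suc l) (?g x)"
      using take_geo[of y x i l] that ge by auto
    then have "length (take (Suc i) (?g y)) = length (take (Suc l) (?g x))" by simp
    then have "i = l" using geo(4)[OF that(1)] geo(4)[OF that(2)] i by simp
    then show ?thesis using i ge[OF that(2)] by simp
  qed
  have pne: "p \<noteq> []" and pd: "distinct p" using p by (auto simp: is_path_def)
  let ?x = "hd p" and ?y = "last p"
  have xy: "?x \<in> set p" "?y \<in> set p" using pne by auto
  \<comment> \<open>\<open>tl\<close> drops the common start \<open>w\<close>. Meeting at any later
    vertex would force a common first step, against \<open>branch\<close>.\<close>
  have disj: "set (?g ?x) \<inter> set (tl (?g ?y)) = {}"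
  proof (rule ccontr)
    assume "\<not> ?thesis"
    then obtain z where "z \<in> set (?g ?x)" "z \<in> set (tl (?g ?y))" by blast
    then obtain i j where "i < length (?g ?x)" "?g ?x ! i = z" "j < length (tl (?g ?y))" "tl (?g ?y) ! j = z"
      unfolding in_set_conv_nth by blast
    then have ij: "i \<le> l" "?g ?x ! i = z" "j < l" "?g ?y ! Suc j = z"
      using geo(4)[OF xy(1)] geo(4)[OF xy(2)] by (simp_all add: nth_tl)
    then have eq: "take (Suc i) (?g ?x) = take (Suc (Suc j)) (?g ?y)"
      using take_geo[OF xy, of i "Suc j"] by auto
    then have "length (take (Suc i) (?g ?x)) = length (take (Suc (Suc j)) (?g ?y))" by simp
    then have "i = Suc j" using geo(4)[OF xy(1)] geo(4)[OF xy(2)] ij by simp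
    then have "?g ?x ! 1 = ?g ?y ! 1"
      using arg_cong[OF eq, of "\<lambda>t. t ! 1"] by simp
    then show False using branch by simp
  qed
  obtain a b p1 where pab: "p = a # p1 @ [b]"
  proof -
    obtain a p' where "p = a # p'" using pne by (cases p) auto
    moreover have "p' \<noteq> []" using calculation p(2) \<open>1 \<le> m\<close> by auto
    ultimately show thesis using that by (metis append_butlast_last_id)
  qed
  then have ab: "?x = a" "?y = b" by auto
  obtain gb where gb: "?g b = w # gb" using geo[OF xy(2)] ab by (cases "?g b") (auto simp: is_path_def)
  have "length gb = l" using geo(4)[OF xy(2)] ab gb by simp
  then have gbne: "gb \<noteq> []" using \<open>1 \<le> l\<close> by auto
  have lastgb: "last gb = b" using geo(3)[OF xy(2)] ab gb gbne by simp
  obtain ga where ga: "?g a = ga @ [a]"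
    using geo[OF xy(1)] ab by (metis append_butlast_last_id is_path_def)
  \<comment> \<open>From \<open>w\<close> down to \<open>a\<close>, through the interior of
    \<open>p\<close>, and back from \<open>b\<close> stopping before \<open>w\<close>:
    \<open>(l + 1) + (m - 1) + l\<close> vertices.\<close>
  let ?c = "?g a @ p1 @ rev gb"
  have lc: "length ?c = 2 * l + m"
    using geo(4)[OF xy(1)] ab \<open>length gb = l\<close> pab p(2) by simp
  let ?R = "\<lambda>x y. {x, y} \<in> E"
  have s1: "successively ?R (ga @ [a])" using geo(1)[OF xy(1)] ab ga by (simp add: is_path_def)
  have HE: "?H \<subseteq> E" by (auto simp: opposite_edges_def)
  have s2: "successively ?R (a # p1 @ [b])"
    using p(1) HE unfolding pab is_path_def successively_conv_nth by blast
  have s3: "successively ?R (rev gb)" "{w, hd gb} \<in> E"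
  proof -
    have *: "successively ?R (w # gb)" using geo(1)[OF xy(2)] ab gb by (simp add: is_path_def)
    then show "{w, hd gb} \<in> E" using gbne by (simp add: successively_Cons)
    have "successively ?R gb" using * gbne by (simp add: successively_Cons)
    then have "successively (\<lambda>x y. {y, x} \<in> E) (rev gb)" by (subst successively_rev) simp
    then show "successively ?R (rev gb)" by (simp add: insert_commute)
  qed
  obtain gb' where gb': "rev gb = b # gb'"
    using gbne lastgb by (metis hd_rev list.exhaust_sel rev_is_Nil_conv)
  have "successively ?R ((a # p1) @ b # gb')"
    using successively_join[of ?R "a # p1" b gb'] s2 s3 gb' by simp
  then have "successively ?R (ga @ a # (p1 @ b # gb'))"
    using successively_join[of ?R ga a "p1 @ b # gb'"] s1 by simp
  then have "successively ?R ?c" using ga gb' by simp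
  moreover have "distinct ?c"
  proof -
    have "set p1 \<inter> set (?g a) = {}" "set p1 \<inter> set (?g b) = {}"
      using inter[of _ a] inter[of _ b] pab pd by fastforce+
    moreover have "distinct (?g a)" "distinct gb" "distinct p1"
      using geo(1)[OF xy(1)] geo(1)[OF xy(2)] ab gb pd pab by (auto simp: is_path_def)
    ultimately show ?thesis using disj ab gb by auto
  qed
  moreover have "{last ?c, hd ?c} \<in> E"
    using s3(2) gbne geo(2)[OF xy(1)] ab ga
    by (metis append_is_Nil_conv hd_append2 insert_commute last_append last_rev not_Cons_self2 rev_is_Nil_conv)
  moreover have "3 \<le> length ?c"
    using lc \<open>1 \<le> l\<close> \<open>1 \<le> m\<close> by linarith
  ultimately show ?thesis
    using contains_cycle_if_closed_path[of E ?c] lc gbne by (simp add: is_path_def)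
qed

section \<open>Counting cycles by their opposite edges\<close>

text \<open>More edges would leave a subgraph of minimum degree above \<open>m + 2\<close>, enough
  for a path with \<open>m\<close> edges between different branches.\<close>

lemma card_opposite_edges_le:
  assumes "simple_graph n E" and girth: "\<And>j. j \<in> {3..2*l} \<Longrightarrow> \<not> contains_cycle E j"
    and "1 \<le> l" "odd m" "\<not> contains_cycle E (2 * l + m)"
  shows "card (opposite_edges E l w) \<le> (m + 2) * n"
proof (rule ccontr)
  let ?H = "opposite_edges E l w"
  assume "\<not> ?thesis"
  then have "(m + 2) * card {..<n} < card ?H" by simp
  moreover have "?H \<subseteq> {{u, v} | u v. u \<in> {..<n} \<and> v \<in> {..<n} \<and> u \<noteq> v}"
    using assms(1) unfolding opposite_edges_def simple_graph_def by blast
  ultimately obtain W where W: "W \<noteq> {}" "\<forall>v\<in>W. m + 2 < card {u\<in>W. {u, v} \<in> ?H}"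
    using exists_min_degree_subgraph[of "{..<n}" ?H "m + 2"] by auto
  have "\<exists>p. is_path ?H p \<and> length p = m + 1 \<and>
      geodesic E l w (hd p) ! 1 \<noteq> geodesic E l w (last p) ! 1"
    using exists_path_with_differently_coloured_ends[of W m ?H "\<lambda>x. geodesic E l w x ! 1"]
      W opposite_edgesD(6)[OF girth] \<open>odd m\<close> by blast
  moreover have "1 \<le> m" using \<open>odd m\<close> by (cases m) auto
  ultimately show False
    using contains_cycle_if_path_in_opposite_edges[OF girth \<open>1 \<le> l\<close>] assms(5) by blast
qed

text \<open>Removing the edge opposite to \<open>w\<close> leaves two arcs with \<open>l\<close>
  edges from \<open>w\<close>, both geodesics. So \<open>w\<close> and \<open>e\<close> determine
  \<open>C\<close>, which is what the count relies on.\<close>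

lemma cycle_from_opposite_edge:
  assumes "simple_graph n E" and girth: "\<And>j. j \<in> {3..2*l} \<Longrightarrow> \<not> contains_cycle E j"
    and "1 \<le> l" "is_cycle_in E (2*l+1) C"
  shows "\<exists>w<n. \<exists>e\<in>opposite_edges E l w. C = insert e (\<Union>x\<in>e. path_edges (geodesic E l w x))"
proof -
  let ?r = "2*l+1"
  obtain vs where inj: "inj_on vs {..<?r}" and C: "C = cycle_edges ?r vs" "C \<subseteq> E"
    using assms(4) by (auto simp: is_cycle_in_def)
  have edge: "{vs i, vs ((i + 1) mod ?r)} \<in> C" if "i < ?r" for i
    using that unfolding C(1) cycle_edges_def by blast
  \<comment> \<open>\<open>?u\<close> runs backwards along the cycle from \<open>vs 0\<close>; the
    outer \<open>mod\<close> sends index 0 to 0 instead of \<open>?r\<close>.\<close>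
  let ?u = "\<lambda>i. (?r - i) mod ?r"
  define p where "p = map vs [0..<l+1]"
  define q where "q = map (\<lambda>i. vs (?u i)) [0..<l+1]"
  have u: "?u i = (if i = 0 then 0 else ?r - i)" for i by auto
  have len: "length p = l + 1" "length q = l + 1" by (simp_all add: p_def q_def)
  have nonempty: "p \<noteq> []" "q \<noteq> []" using len by auto
  have pn: "p ! i = vs i" "q ! i = vs (?u i)" if "i \<le> l" for i
    using that unfolding p_def q_def by (simp_all del: upt_Suc)
  have pe: "{p ! i, p ! Suc i} = {vs i, vs ((i + 1) mod ?r)}" if "i < l" for i
    using that by (simp add: pn)
  \<comment> \<open>The edges of \<open>q\<close> have cycle indices \<open>2*l\<close> down to
    \<open>l + 1\<close>; those of \<open>p\<close> have indices below \<open>l\<close>, which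
    leaves index \<open>l\<close> for the opposite edge.\<close>
  have qe: "{q ! i, q ! Suc i} = {vs (2*l - i), vs ((2*l - i + 1) mod ?r)}" if "i < l" for i
  proof -
    have "?u (Suc i) = 2*l - i" "?u i = (2*l - i + 1) mod ?r"
      using that by (simp_all add: u Suc_diff_le)
    then show ?thesis using that pn(2)[of i] pn(2)[of "Suc i"] by (simp add: insert_commute)
  qed
  have "is_path E p"
    unfolding is_path_def successively_conv_nth
  proof (intro conjI allI impI)
    show "p \<noteq> []" by (simp add: p_def)
    have "inj_on vs (set [0..<l+1])" by (rule inj_on_subset[OF inj]) auto
    then show "distinct p" unfolding p_def distinct_map by simp
    fix i assume "Suc i < length p"
    then show "{p ! i, p ! Suc i} \<in> E" using pe[of i] edge[of i] C(2) len by auto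
  qed
  moreover have "is_path E q"
    unfolding is_path_def successively_conv_nth
  proof (intro conjI allI impI)
    show "q \<noteq> []" by (simp add: q_def)
    show "distinct q" unfolding q_def distinct_map
    proof
      show "inj_on (\<lambda>i. vs (?u i)) (set [0..<l+1])"
      proof (rule inj_onI)
        fix i j assume ij: "i \<in> set [0..<l+1]" "j \<in> set [0..<l+1]" "vs (?u i) = vs (?u j)"
        have "?u i = ?u j" by (rule inj_onD[OF inj ij(3)]) auto
        then show "i = j" using ij(1,2) unfolding u by (auto split: if_splits)
      qed
    qed simp
    fix i assume "Suc i < length q"
    then show "{q ! i, q ! Suc i} \<in> E" using qe[of i] edge[of "2*l-i"] C(2) len by auto
  qed
  moreover have "hd p = vs 0" "hd q = vs 0" "last p = vs l" "last q = vs (l + 1)"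
    using len nonempty pn[of 0] pn[of l] \<open>1 \<le> l\<close> hd_conv_nth[of p] hd_conv_nth[of q] last_conv_nth[of p] last_conv_nth[of q]
    by (auto simp: u)
  moreover have "p ! 1 \<noteq> q ! 1"
    using inj_onD[OF inj, of 1 "2*l"] pn[of 1] \<open>1 \<le> l\<close> by (auto simp: u)
  moreover have e: "{vs l, vs (l + 1)} \<in> C" using edge[of l] \<open>1 \<le> l\<close> by simp
  moreover have g: "geodesic E l (vs 0) (vs l) = p" "geodesic E l (vs 0) (vs (l + 1)) = q"
    by (rule geodesic_eqI[OF girth]; use calculation len in auto)+
  ultimately have opp: "{vs l, vs (l + 1)} \<in> opposite_edges E l (vs 0)"
    using len C(2) unfolding opposite_edges_def by blast
  have "C = insert {vs l, vs (l + 1)} (path_edges p \<union> path_edges q)" (is "_ = ?D")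
  proof
    show "?D \<subseteq> C"
    proof -
      have "path_edges p \<subseteq> C" 
      proof
        fix f assume "f \<in> path_edges p"
        then obtain i where "i < l" "f = {p ! i, p ! Suc i}" unfolding path_edges_def using len by auto
        then show "f \<in> C" using pe[of i] edge[of i] by simp
      qed
      moreover have "path_edges q \<subseteq> C"
      proof
        fix f assume "f \<in> path_edges q"
        then obtain i where "i < l" "f = {q ! i, q ! Suc i}" unfolding path_edges_def using len by auto
        then show "f \<in> C" using qe[of i] edge[of "2*l-i"] by simp
      qed
      ultimately show ?thesis using e by blast
    qed
    show "C \<subseteq> ?D"
    proof
      fix f assume "f \<in> C"
      then obtain i where i: "i < ?r" "f = {vs i, vs ((i + 1) mod ?r)}"
        unfolding C(1) cycle_edges_def by blast
      consider "i < l" | "i = l" | "i > l" by linarith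
      then show "f \<in> ?D"
      proof cases
        case 1
        then have "f \<in> path_edges p" using i pe[of i] len unfolding path_edges_def by auto
        then show ?thesis by blast
      next
        case 2
        then show ?thesis using i \<open>1 \<le> l\<close> by simp
      next
        case 3
        then have "2*l - (2*l - i) = i" "2*l - i < l" using i by auto
        then have "f = {q ! (2*l - i), q ! (2*l - i + 1)}" using qe[of "2*l-i"] i by simp
        then have "f \<in> path_edges q" using \<open>2*l - i < l\<close> len unfolding path_edges_def by auto
        then show ?thesis by blast
      qed
    qed
  qed
  then have "C = insert {vs l, vs (l + 1)} (\<Union>x\<in>{vs l, vs (l + 1)}. path_edges (geodesic E l (vs 0) x))"
    using g by simp
  moreover have "vs 0 < n"
  proof -
    have "{vs 0, vs 1} \<in> E" using edge[of 0] C(2) \<open>1 \<le> l\<close> by auto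
    then show ?thesis using assms(1) unfolding simple_graph_def by (auto simp: doubleton_eq_iff)
  qed
  ultimately show ?thesis using opp by (intro exI[of _ "vs 0"] conjI bexI[of _ "{vs l, vs (l + 1)}"])
qed

lemma finite_simple_graph: "simple_graph n E \<Longrightarrow> finite E"
  by (rule finite_subset[of _ "Pow {..<n}"]) (auto simp: simple_graph_def)

lemma count_odd_cycles_le:
  assumes "simple_graph n E" and girth: "\<And>j. j \<in> {3..2*l} \<Longrightarrow> \<not> contains_cycle E j"
    and "1 \<le> l" "odd m" "\<not> contains_cycle E (2 * l + m)"
  shows "count_cycles E (2*l+1) \<le> (m + 2) * n ^ 2"
proof -
  let ?f = "\<lambda>w e. insert e (\<Union>x\<in>e. path_edges (geodesic E l w x))"
  have fin: "finite (opposite_edges E l w)" for w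
    by (rule finite_subset[OF _ finite_simple_graph[OF assms(1)]]) (auto simp: opposite_edges_def)
  have "{C. is_cycle_in E (2*l+1) C} \<subseteq> (\<Union>w<n. ?f w ` opposite_edges E l w)"
    using cycle_from_opposite_edge[OF assms(1) girth \<open>1 \<le> l\<close>] by blast
  then have "count_cycles E (2*l+1) \<le> card (\<Union>w<n. ?f w ` opposite_edges E l w)"
    unfolding count_cycles_def using fin by (intro card_mono) auto
  also have "\<dots> \<le> (\<Sum>w<n. card (?f w ` opposite_edges E l w))"
    by (rule card_UN_le) simp
  also have "\<dots> \<le> (\<Sum>w<n. (m + 2) * n)"
    by (intro sum_mono order.trans[OF card_image_le[OF fin] card_opposite_edges_le[OF assms]])
  finally show ?thesis by (simp add: power2_eq_square algebra_simps)
qed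

section \<open>Lower bound\<close>

text \<open>Allowing a step to stay in place turns the \<open>i\<close>-th power of adjacency into
  "distance at most \<open>i\<close>".\<close>

definition close :: "nat set set \<Rightarrow> nat \<Rightarrow> (nat \<times> nat) set" where
  "close E i = {(x, y). x = y \<or> {x, y} \<in> E} ^^ i"

lemma close_refl: "(x, x) \<in> close E i"
  by (induction i) (auto simp: close_def)

lemma close_Suc: "(x, z) \<in> close E (Suc i) \<longleftrightarrow> (\<exists>y. (x, y) \<in> close E i \<and> (y = z \<or> {y, z} \<in> E))"
  by (auto simp: close_def)

lemma close_sym: "(x, y) \<in> close E i \<Longrightarrow> (y, x) \<in> close E i"
proof (induction i arbitrary: y)
  case 0
  then show ?case by (simp add: close_def)
next
  case (Suc i)
  then obtain z where "(z, x) \<in> close E i" "y = z \<or> {y, z} \<in> E"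
    by (auto simp: close_Suc insert_commute)
  then show ?case unfolding close_def by (intro relpow_Suc_I2[where y = z]) auto
qed

lemma close_mono: "(x, y) \<in> close E i \<Longrightarrow> i \<le> j \<Longrightarrow> (x, y) \<in> close E j"
  by (induction j) (auto simp: close_Suc le_Suc_eq)

text \<open>Each vertex of a ball contributes itself and at most \<open>D\<close> neighbours to the
  next ball; distinct neighbours give distinct incident edges.\<close>

lemma card_close_le:
  assumes "finite E" "\<And>v. card {e\<in>E. v \<in> e} \<le> D"
  shows "finite (close E i `` {x}) \<and> card (close E i `` {x}) \<le> (D + 1) ^ i"
proof (induction i)
  case 0
  then show ?case by (simp add: close_def)
next
  case (Suc i)
  let ?B = "close E i `` {x}" and ?N = "\<lambda>y. insert y {u. {y, u} \<in> E}"
  have N: "finite (?N y) \<and> card (?N y) \<le> D + 1" for y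
  proof -
    have inj: "inj_on (\<lambda>u. {y, u}) {u. {y, u} \<in> E}"
      by (auto simp: inj_on_def doubleton_eq_iff)
    have sub: "(\<lambda>u. {y, u}) ` {u. {y, u} \<in> E} \<subseteq> {e\<in>E. y \<in> e}" by auto
    have fin: "finite {u. {y, u} \<in> E}"
      using inj_on_finite[OF inj sub] assms(1) by simp
    have "card {u. {y, u} \<in> E} \<le> D"
      using card_inj_on_le[OF inj sub] assms(1) assms(2)[of y] by simp
    then show ?thesis using fin by (simp add: card_insert_if)
  qed
  have "close E (Suc i) `` {x} = (\<Union>y\<in>?B. ?N y)"
    by (auto simp: close_Suc)
  moreover have "card (\<Union>y\<in>?B. ?N y) \<le> (\<Sum>y\<in>?B. card (?N y))"
    using Suc by (intro card_UN_le) auto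
  moreover have "(\<Sum>y\<in>?B. card (?N y)) \<le> card ?B * (D + 1)"
    using sum_bounded_above[of ?B "\<lambda>y. card (?N y)" "D + 1"] N by auto
  moreover have "card ?B * (D + 1) \<le> (D + 1) ^ Suc i"
    using Suc mult_le_mono1[of "card ?B" "(D + 1) ^ i" "D + 1"] by (simp add: mult.commute)
  ultimately show ?case using Suc N by auto
qed

text \<open>Greedy choice: the balls of radius \<open>M\<close> around the vertices chosen so far
  are too small to cover \<open>S\<close>.\<close>

lemma exists_far_apart_vertices:
  assumes "finite E" "\<And>v. card {e\<in>E. v \<in> e} \<le> D" "r * (D + 1) ^ M < card S"
  shows "\<exists>xs. length xs = r \<and> set xs \<subseteq> S \<and> distinct xs \<and>
    (\<forall>x\<in>set xs. \<forall>y\<in>set xs. x \<noteq> y \<longrightarrow> (x, y) \<notin> close E M)"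
  using assms(3)
proof (induction r)
  case 0
  then show ?case by (intro exI[of _ "[]"]) auto
next
  case (Suc r)
  then obtain xs where xs: "length xs = r" "set xs \<subseteq> S" "distinct xs"
    "\<forall>x\<in>set xs. \<forall>y\<in>set xs. x \<noteq> y \<longrightarrow> (x, y) \<notin> close E M" by auto
  let ?B = "\<Union>x\<in>set xs. close E M `` {x}"
  have "card ?B \<le> (\<Sum>x\<in>set xs. card (close E M `` {x}))" by (rule card_UN_le) simp
  also have "\<dots> \<le> card (set xs) * (D + 1) ^ M"
    using sum_bounded_above[of "set xs" "\<lambda>x. card (close E M `` {x})" "(D + 1) ^ M"]
      card_close_le[OF assms(1,2)] by auto
  also have "\<dots> = r * (D + 1) ^ M" using xs distinct_card by fastforce
  finally have "card ?B < card S" using Suc.prems by simp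
  moreover have "finite ?B" using card_close_le[OF assms(1,2)] by auto
  ultimately obtain z where z: "z \<in> S" "z \<notin> ?B"
    by (meson card_mono not_less subsetI)
  then have "z \<notin> set xs" using close_refl by auto
  then show ?case
    using xs z close_sym by (intro exI[of _ "z # xs"]) fastforce
qed

section \<open>Edges of cycles, and cycles inside a union\<close>

text \<open>With indices running over all naturals, arcs may wrap around without case
  distinctions.\<close>

lemma cycle_edges_mod:
  assumes "0 < k"
  shows "cycle_edges k vs = {{vs (i mod k), vs (Suc i mod k)} | i. True}"
proof -
  have "\<exists>j<k. {vs (i mod k), vs (Suc i mod k)} = {vs j, vs ((j + 1) mod k)}" for i
    by (rule exI[of _ "i mod k"]) (use assms in \<open>simp add: mod_Suc_eq\<close>)
  moreover have "\<exists>i. {vs j, vs ((j + 1) mod k)} = {vs (i mod k), vs (Suc i mod k)}" if "j < k" for j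
    by (rule exI[of _ j]) (use that in simp)
  ultimately show ?thesis unfolding cycle_edges_def by blast
qed

lemma mod_add_neq:
  assumes "inj_on vs {..<k}" "0 < s" "s < (k::nat)"
  shows "vs ((b + s) mod k) \<noteq> vs (b mod k)"
proof
  assume "vs ((b + s) mod k) = vs (b mod k)"
  then have "(b + s) mod k = b mod k"
    using inj_onD[OF assms(1)] assms(3) by simp
  then have "k dvd s" using mod_eq_dvd_iff_nat[of b "b + s" k] by simp
  then show False using assms(2,3) by (meson dvd_imp_le not_less)
qed

lemma Union_cycle_edges: "0 < k \<Longrightarrow> \<Union>(cycle_edges k vs) = vs ` {..<k}"
  by (auto simp: cycle_edges_def intro!: exI[of _ "{_, _}"])

text \<open>Indexing the vertex by \<open>Suc i\<close> names both of its neighbours without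
  subtraction.\<close>

lemma edges_at_cycle_vertex:
  assumes "inj_on vs {..<k}" "0 < k"
  shows "{e \<in> cycle_edges k vs. vs (Suc i mod k) \<in> e} \<subseteq>
    {{vs (Suc i mod k), vs (i mod k)}, {vs (Suc i mod k), vs (Suc (Suc i) mod k)}}"
proof
  fix e assume e: "e \<in> {e \<in> cycle_edges k vs. vs (Suc i mod k) \<in> e}"
  then obtain j where j: "e = {vs (j mod k), vs (Suc j mod k)}"
    using cycle_edges_mod[OF assms(2)] by auto
  with e consider "vs (Suc i mod k) = vs (j mod k)" | "vs (Suc i mod k) = vs (Suc j mod k)" by auto
  then show "e \<in> {{vs (Suc i mod k), vs (i mod k)}, {vs (Suc i mod k), vs (Suc (Suc i) mod k)}}"
  proof cases
    case 1
    then have "Suc i mod k = j mod k" using inj_onD[OF assms(1)] assms(2) by simp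
    then have "Suc (Suc i) mod k = Suc j mod k" by (metis mod_Suc_eq)
    then show ?thesis using j 1 by simp
  next
    case 2
    then have "Suc i mod k = Suc j mod k" using inj_onD[OF assms(1)] assms(2) by simp
    \<comment> \<open>Adding \<open>k - 1\<close> undoes the successor modulo
      \<open>k\<close>.\<close>
    then have "(Suc i + (k - 1)) mod k = (Suc j + (k - 1)) mod k" by (rule mod_add_cong) simp
    then have "i mod k = j mod k" using assms(2) by simp
    then show ?thesis using j 2 by (simp add: insert_commute)
  qed
qed

text \<open>A vertex of the inner cycle has two distinct neighbours on it, which must be its two
  neighbours on the outer cycle. So the inner vertex set is closed under the outer successor and
  contains all outer vertices.\<close>

lemma cycle_length_eq_if_subset:
  assumes "inj_on vs {..<j}" "3 \<le> j" "inj_on us {..<r}" "3 \<le> r"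
    and sub: "cycle_edges j vs \<subseteq> cycle_edges r us"
  shows "j = r"
proof -
  let ?v = "\<lambda>i. vs (i mod j)" and ?u = "\<lambda>i. us (i mod r)"
  have edge: "{?v i, ?v (Suc i)} \<in> cycle_edges r us" for i
    using sub cycle_edges_mod[of j vs] assms(2) by auto
  have V: "range ?v \<subseteq> us ` {..<r}"
    using edge Union_cycle_edges[of r us] assms(4) by fastforce
  have step: "?u (Suc i) \<in> range ?v" if ui: "?u i \<in> range ?v" for i
  proof -
    obtain b where b: "?u i = ?v b" using ui by auto
    \<comment> \<open>Adding a full turn first keeps the predecessor index a natural number even for
      \<open>b = 0\<close>.\<close>
    have vb: "?v (b + j) = ?v b" "Suc (b + j - 1) = b + j" "?v (Suc (b + j)) = ?v (Suc b)"
      using assms(2) by (simp_all add: mod_Suc_eq[symmetric, of "b + j"] mod_Suc_eq)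
    have ui: "?u (i + r) = ?u i" "Suc (i + r - 1) = i + r" "?u (Suc (i + r)) = ?u (Suc i)"
      using assms(4) by (simp_all add: mod_Suc_eq[symmetric, of "i + r"] mod_Suc_eq)
    let ?p = "?v (b + j - 1)" and ?n = "?v (Suc b)"
    have "{?u i, ?p} \<in> cycle_edges r us" "{?u i, ?n} \<in> cycle_edges r us"
      using edge[of "b + j - 1"] edge[of b] b vb by (simp_all add: insert_commute)
    then have "{?u i, ?p} \<in> {{?u i, ?u (i + r - 1)}, {?u i, ?u (Suc i)}}"
      "{?u i, ?n} \<in> {{?u i, ?u (i + r - 1)}, {?u i, ?u (Suc i)}}"
      using edges_at_cycle_vertex[OF assms(3), of "i + r - 1"] assms(4) ui by auto
    moreover have "?n \<noteq> ?p"
    proof -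
      have "Suc (b + j) = (b + j - 1) + 2" using assms(2) by simp
      then show ?thesis
        using mod_add_neq[OF assms(1), of 2 "b + j - 1"] assms(2) vb(3) by simp
    qed
    ultimately have "?u (Suc i) = ?p \<or> ?u (Suc i) = ?n"
      by (auto simp: doubleton_eq_iff)
    then show ?thesis by blast
  qed
  obtain i0 where i0: "?v 0 = ?u i0" "i0 < r" 
  proof -
    have "?v 0 \<in> us ` {..<r}" using V by blast
    then obtain i where "?v 0 = us i" "i < r" by blast
    then show thesis using that[of i] by simp
  qed
  have "?u (i0 + i) \<in> range ?v" for i
  proof (induction i)
    case 0
    show ?case unfolding add_0_right i0(1)[symmetric] by blast
  next
    case (Suc i)
    then show ?case using step[of "i0 + i"] by simp
  qed
  \<comment> \<open>Starting from \<open>i0\<close>, \<open>i + r - i0\<close> steps lead to index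
    \<open>i\<close> modulo \<open>r\<close>.\<close>
  moreover have "?u (i0 + (i + r - i0)) = us i" if "i < r" for i
    using that i0(2) by simp
  ultimately have "us i \<in> range ?v" if "i < r" for i
    using that by metis
  then have "us ` {..<r} \<subseteq> range ?v" by blast
  moreover have "range ?v = vs ` {..<j}"
  proof
    show "range ?v \<subseteq> vs ` {..<j}" using assms(2) by auto
    show "vs ` {..<j} \<subseteq> range ?v"
    proof
      fix y assume "y \<in> vs ` {..<j}"
      then obtain i where "y = vs i" "i < j" by blast
      then have "y = ?v i" by simp
      then show "y \<in> range ?v" by blast
    qed
  qed
  ultimately have "us ` {..<r} = vs ` {..<j}" using V by auto
  then show ?thesis using card_image[OF assms(1)] card_image[OF assms(3)] by simp
qed

text \<open>A short cycle using both an edge outside \<open>E\<close> and one inside contains an arc of \<open>E\<close> between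
  two distinct vertices of the new cycle, which are far apart.\<close>
lemma short_cycle_in_union:
  assumes "inj_on vs {..<j}" "3 \<le> j" "j \<le> M" and sub: "cycle_edges j vs \<subseteq> E \<union> N"
    and far: "\<And>x y. x \<in> \<Union>N \<Longrightarrow> y \<in> \<Union>N \<Longrightarrow> x \<noteq> y \<Longrightarrow> (x, y) \<notin> close E M"
  shows "cycle_edges j vs \<subseteq> E \<or> cycle_edges j vs \<subseteq> N"
proof (rule ccontr)
  assume not: "\<not> ?thesis"
  let ?v = "\<lambda>i. vs (i mod j)" let ?e = "\<lambda>i. {?v i, ?v (Suc i)}"
  have ce: "cycle_edges j vs = {?e i | i. True}" using cycle_edges_mod[of j vs] assms(2) by simp
  have EN: "?e i \<in> E \<union> N" for i using sub ce by auto
  obtain a where a: "?e a \<notin> E" using not ce by auto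
  obtain b where b: "?e b \<notin> N" using not ce by auto
  have "\<exists>t. ?e (a + t) \<in> E"
  proof (intro exI)
    \<comment> \<open>Shifting \<open>b\<close> by the multiple \<open>j * a\<close> of the period
      makes its offset from \<open>a\<close> nonnegative.\<close>
    have "a \<le> j * a" using assms(2) by simp
    then have "a + (b + j * a - a) = b + j * a" by linarith
    then have "(a + (b + j * a - a)) mod j = b mod j" by simp
    moreover from this have "Suc (a + (b + j * a - a)) mod j = Suc b mod j" by (metis mod_Suc_eq)
    ultimately show "?e (a + (b + j * a - a)) \<in> E" using b EN[of b] by simp
  qed
  \<comment> \<open>At the least such \<open>t\<close> the cycle passes from an edge of
    \<open>N\<close> to one of \<open>E\<close>, so the vertex \<open>?c\<close> lies on
    \<open>N\<close>.\<close>
  then obtain t where t: "?e (a + t) \<in> E" "\<And>s. s < t \<Longrightarrow> ?e (a + s) \<notin> E"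
    using exists_least_iff[of "\<lambda>t. ?e (a + t) \<in> E"] by blast
  then have "t \<noteq> 0" using a by (cases t) auto
  let ?c = "a + t"
  have prev: "?e (?c - 1) \<in> N" "Suc (?c - 1) = ?c"
    using t(2)[of "t - 1"] EN[of "?c - 1"] \<open>t \<noteq> 0\<close> by auto
  then have cN: "?v ?c \<in> \<Union>N" by auto
  have "?v (?c + (j - 1)) \<in> \<Union>N"
  proof -
    have "?c + (j - 1) = (?c - 1) + j" using \<open>t \<noteq> 0\<close> assms(2) by simp
    then have "?v (?c + (j - 1)) = ?v (?c - 1)" by simp
    then show ?thesis using prev(1) by auto
  qed
  then have ex: "0 < j - 1 \<and> ?v (?c + (j - 1)) \<in> \<Union>N" using assms(2) by simp
  \<comment> \<open>The first return to a vertex of \<open>N\<close>. Before it every edge has an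
    end off \<open>N\<close> or is the first one, so the arc runs in \<open>E\<close>; the vertex
    before \<open>?c\<close> bounds \<open>s\<close> by \<open>j - 1\<close>, which keeps the ends
    distinct.\<close>
  define s where "s = (LEAST s. 0 < s \<and> ?v (?c + s) \<in> \<Union>N)"
  have s: "0 < s" "?v (?c + s) \<in> \<Union>N"
    using LeastI[of "\<lambda>s. 0 < s \<and> ?v (?c + s) \<in> \<Union>N", OF ex] unfolding s_def by auto
  have sj: "s \<le> j - 1"
    using Least_le[of "\<lambda>s. 0 < s \<and> ?v (?c + s) \<in> \<Union>N", OF ex] unfolding s_def by auto
  have inE: "?e (?c + i) \<in> E" if "i < s" for i
  proof (cases "i = 0")
    case False
    then have "?v (?c + i) \<notin> \<Union>N"
      using not_less_Least[of i "\<lambda>s. 0 < s \<and> ?v (?c + s) \<in> \<Union>N"] that unfolding s_def by auto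
    then show ?thesis using EN[of "?c + i"] by auto
  qed (use t in auto)
  have "(?v ?c, ?v (?c + i)) \<in> close E i" if "i \<le> s" for i
    using that
  proof (induction i)
    case (Suc i)
    then show ?case using inE[of i] by (auto simp: close_Suc)
  qed (simp add: close_refl)
  then have "(?v ?c, ?v (?c + s)) \<in> close E M"
    using close_mono[of _ _ E s M] sj assms(3) by auto
  moreover have "?v ?c \<noteq> ?v (?c + s)"
  proof -
    have "s < j" using sj assms(2) by linarith
    then show ?thesis using mod_add_neq[OF assms(1) s(1), of ?c] by metis
  qed
  ultimately show False using far[OF cN s(2)] by blast
qed

section \<open>Greedy addition of cycles\<close>

lemma not_contains_cycle_empty: "\<not> contains_cycle {} j"
  by (force simp: contains_cycle_def is_cycle_in_def cycle_edges_def)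

lemma finite_cycles: "finite E \<Longrightarrow> finite {C. is_cycle_in E j C}"
  by (rule finite_subset[of _ "Pow E"]) (auto simp: is_cycle_in_def)

lemma sum_degrees:
  assumes "simple_graph n E"
  shows "(\<Sum>v<n. card {e\<in>E. v \<in> e}) = 2 * card E"
proof -
  have "\<forall>e\<in>E. card {v\<in>{..<n}. v \<in> e} = 2"
  proof
    fix e assume "e \<in> E"
    then obtain a b where "e = {a, b}" "a < n" "b < n" "a \<noteq> b"
      using assms unfolding simple_graph_def by blast
    moreover from this have "{v\<in>{..<n}. v \<in> e} = {a, b}" by auto
    ultimately show "card {v\<in>{..<n}. v \<in> e} = 2" by simp
  qed
  then have "(\<Sum>v<n. card {e\<in>E. v \<in> e}) = (\<Sum>e\<in>E. 2)"
    using finite_simple_graph[OF assms] by (intro sum_multicount_gen) auto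
  then show ?thesis by simp
qed

text \<open>By \<open>short_cycle_in_union\<close> a cycle with length in \<open>F\<close> would lie
  in \<open>E\<close> or in the new cycle, and the latter contains only a cycle of length
  \<open>length xs\<close>. Degrees grow by at most 2, only at vertices with room for it.\<close>

lemma extend_by_cycle:
  assumes E: "simple_graph n E" and free: "\<And>j. j \<in> F \<Longrightarrow> \<not> contains_cycle E j"
    and deg: "\<And>v. card {e\<in>E. v \<in> e} \<le> D" and F: "F \<subseteq> {..M}" "length xs \<notin> F"
    and xs: "3 \<le> length xs" "distinct xs" "set xs \<subseteq> {v. v < n \<and> card {e\<in>E. v \<in> e} + 2 \<le> D}"
    and M: "1 \<le> M"
    and far: "\<And>x y. x \<in> set xs \<Longrightarrow> y \<in> set xs \<Longrightarrow> x \<noteq> y \<Longrightarrow> (x, y) \<notin> close E M"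
  defines "E' \<equiv> E \<union> cycle_edges (length xs) ((!) xs)"
  shows "simple_graph n E'" "\<And>j. j \<in> F \<Longrightarrow> \<not> contains_cycle E' j"
    "\<And>v. card {e\<in>E'. v \<in> e} \<le> D" "card E < card E'" "card E' \<le> card E + length xs"
    "count_cycles E (length xs) < count_cycles E' (length xs)"
proof -
  let ?r = "length xs" and ?N = "cycle_edges (length xs) ((!) xs)"
  have inj: "inj_on ((!) xs) {..<?r}" using xs(2) by (simp add: inj_on_nth)
  have r: "0 < ?r" using xs(1) by linarith
  have UN: "\<Union>?N = set xs"
    using Union_cycle_edges[OF r, of "(!) xs"] by (auto simp: set_conv_nth)
  have N: "\<exists>a b. e = {a, b} \<and> a \<in> set xs \<and> b \<in> set xs \<and> a \<noteq> b" if "e \<in> ?N" for e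
  proof -
    obtain i where "e = {xs ! (i mod ?r), xs ! (Suc i mod ?r)}"
      using \<open>e \<in> ?N\<close> cycle_edges_mod[OF r] by auto
    moreover have "xs ! (Suc i mod ?r) \<noteq> xs ! (i mod ?r)"
      using mod_add_neq[OF inj, of 1 i] xs(1) by simp
    moreover have "xs ! (t mod ?r) \<in> set xs" for t using r by simp
    ultimately show ?thesis by metis
  qed
  then show simple: "simple_graph n E'"
    using E xs(3) unfolding simple_graph_def E'_def by blast
  have finE: "finite E" "finite E'" using finite_simple_graph E simple by auto
  \<comment> \<open>An old edge would put two entries of \<open>xs\<close> at distance at most 1,
    hence at most \<open>M\<close>.\<close>
  have disj: "e \<notin> E" if eN: "e \<in> ?N" for e
  proof
    assume "e \<in> E"
    obtain a b where ab: "e = {a, b}" "a \<in> set xs" "b \<in> set xs" "a \<noteq> b" using N[OF eN] by blast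
    then have "(a, b) \<in> close E (Suc 0)" 
      using \<open>e \<in> E\<close> close_refl[of a E 0] unfolding close_Suc by blast
    then have "(a, b) \<in> close E M" using close_mono M by auto
    then show False using far ab by blast
  qed
  have Nne: "?N \<noteq> {}"
    using UN r by (metis Sup_empty length_pos_if_in_set less_irrefl list.size(3) set_empty)
  show "\<not> contains_cycle E' j" if "j \<in> F" for j
  proof
    assume "contains_cycle E' j"
    then obtain vs where vs: "3 \<le> j" "inj_on vs {..<j}" "cycle_edges j vs \<subseteq> E \<union> ?N"
      unfolding contains_cycle_def is_cycle_in_def E'_def by auto
    have "j \<le> M" using F(1) \<open>j \<in> F\<close> by auto
    then have "cycle_edges j vs \<subseteq> E \<or> cycle_edges j vs \<subseteq> ?N"
      using short_cycle_in_union[OF vs(2,1) _ vs(3)] far UN by auto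
    then show False
    proof
      assume "cycle_edges j vs \<subseteq> E"
      then have "contains_cycle E j" using vs unfolding contains_cycle_def is_cycle_in_def by blast
      then show False using free \<open>j \<in> F\<close> by blast
    next
      assume "cycle_edges j vs \<subseteq> ?N"
      then have "j = ?r" using cycle_length_eq_if_subset[OF vs(2,1) inj xs(1)] by blast
      then show False using F(2) \<open>j \<in> F\<close> by blast
    qed
  qed
  show "card {e\<in>E'. v \<in> e} \<le> D" for v
  proof (cases "v \<in> set xs")
    case False
    then have "{e\<in>E'. v \<in> e} = {e\<in>E. v \<in> e}" using UN unfolding E'_def by blast
    then show ?thesis using deg by simp
  next
    case True
    then obtain i where i: "i < ?r" "v = xs ! i" by (auto simp: in_set_conv_nth)
    have "xs ! (Suc (i + ?r - 1) mod ?r) = v"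
    proof -
      have "Suc (i + ?r - 1) = i + ?r" using r by simp
      then show ?thesis using i by simp
    qed
    then have "\<exists>a b. {e\<in>?N. v \<in> e} \<subseteq> {a, b}"
      using edges_at_cycle_vertex[OF inj r, of "i + ?r - 1"] by metis
    then obtain a b where "{e\<in>?N. v \<in> e} \<subseteq> {a, b}" by blast
    then have "card {e\<in>?N. v \<in> e} \<le> card {a, b}" by (intro card_mono) auto
    also have "\<dots> \<le> 2" by (simp add: card_insert_if)
    finally have 2: "card {e\<in>?N. v \<in> e} \<le> 2" .
    have "{e\<in>E'. v \<in> e} = {e\<in>E. v \<in> e} \<union> {e\<in>?N. v \<in> e}" unfolding E'_def by blast
    then have "card {e\<in>E'. v \<in> e} \<le> card {e\<in>E. v \<in> e} + card {e\<in>?N. v \<in> e}"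
      using card_Un_le[of "{e\<in>E. v \<in> e}" "{e\<in>?N. v \<in> e}"] by simp
    then show ?thesis using 2 True xs(3) by auto
  qed
  have "E \<subset> E'" using disj Nne unfolding E'_def by blast
  then show "card E < card E'" using finE by (intro psubset_card_mono)
  have "?N = (\<lambda>i. {xs ! i, xs ! ((i + 1) mod ?r)}) ` {..<?r}" unfolding cycle_edges_def by auto
  then have "card ?N \<le> ?r" by (metis card_image_le card_lessThan finite_lessThan)
  then show "card E' \<le> card E + ?r" using card_Un_le[of E ?N] unfolding E'_def by linarith
  have "is_cycle_in E' ?r ?N" "\<not> is_cycle_in E ?r ?N"
    using xs(1) inj disj Nne unfolding is_cycle_in_def E'_def by blast+
  moreover have "is_cycle_in E' ?r C" if "is_cycle_in E ?r C" for C
    using that unfolding is_cycle_in_def E'_def by blast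
  ultimately have "{C. is_cycle_in E ?r C} \<subset> {C. is_cycle_in E' ?r C}" by blast
  then show "count_cycles E ?r < count_cycles E' ?r"
    unfolding count_cycles_def using finite_cycles finE by (intro psubset_card_mono) auto
qed

text \<open>An edge-maximal graph in the class \<open>?P\<close> cannot be extended, so few vertices
  have degree at most \<open>D - 2\<close>. The invariant on \<open>card E\<close> persists because
  each extension adds at most \<open>r\<close> edges and at least one cycle; it turns many edges
  into many cycles.\<close>

lemma exists_graph_with_many_cycles:
  assumes "3 \<le> r" "F \<subseteq> {..M}" "r \<notin> F" "1 \<le> M" and n: "2 * r * (D + 1) ^ M \<le> n"
  shows "\<exists>E. simple_graph n E \<and> (\<forall>j\<in>F. \<not> contains_cycle E j) \<and> n * (D - 1) \<le> 4 * r * count_cycles E r"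
proof -
  let ?P = "\<lambda>E. simple_graph n E \<and> (\<forall>j\<in>F. \<not> contains_cycle E j) \<and>
    (\<forall>v. card {e\<in>E. v \<in> e} \<le> D) \<and> card E \<le> r * count_cycles E r"
  have "?P {}" using not_contains_cycle_empty by (auto simp: simple_graph_def)
  moreover have "\<forall>E. ?P E \<longrightarrow> card E \<le> card (Pow {..<n})"
    by (intro allI impI card_mono) (auto simp: simple_graph_def)
  ultimately obtain E where E: "?P E" and max: "\<And>E'. ?P E' \<Longrightarrow> card E' \<le> card E"
    using ex_has_greatest_nat[of ?P "{}" card "Suc (card (Pow {..<n}))"] unfolding less_Suc_eq_le by blast
  have finE: "finite E" using E finite_simple_graph by blast
  let ?d = "\<lambda>v. card {e\<in>E. v \<in> e}"
  define S where "S = {v. v < n \<and> ?d v + 2 \<le> D}"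
  have S: "card S \<le> r * (D + 1) ^ M"
  proof (rule ccontr)
    assume "\<not> ?thesis"
    then obtain xs where xs: "length xs = r" "set xs \<subseteq> S" "distinct xs"
      "\<forall>x\<in>set xs. \<forall>y\<in>set xs. x \<noteq> y \<longrightarrow> (x, y) \<notin> close E M"
      using exists_far_apart_vertices[OF finE, of D r M S] E by auto
    let ?E' = "E \<union> cycle_edges (length xs) ((!) xs)"
    have ext: "simple_graph n ?E'" "\<And>j. j \<in> F \<Longrightarrow> \<not> contains_cycle ?E' j"
      "\<And>v. card {e\<in>?E'. v \<in> e} \<le> D" "card E < card ?E'" "card ?E' \<le> card E + length xs"
      "count_cycles E (length xs) < count_cycles ?E' (length xs)"
      using extend_by_cycle[of n E F D M xs] E xs assms unfolding S_def by auto
    have "card ?E' \<le> r * count_cycles E r + r" using ext(5) E xs(1) by simp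
    also have "\<dots> = r * Suc (count_cycles E r)" by simp
    also have "\<dots> \<le> r * count_cycles ?E' r" using ext(6) xs(1) by (intro mult_le_mono2) simp
    finally have "?P ?E'" using ext by blast
    then show False using max[of ?E'] ext(4) by simp
  qed
  have Sn: "S \<subseteq> {..<n}" unfolding S_def by auto
  \<comment> \<open>The factor 2 in the hypothesis on \<open>n\<close> makes \<open>S\<close> at
    most half of the vertices; the others have degree at least \<open>D - 1\<close>.\<close>
  have "n \<le> 2 * (n - card S)" using S n by simp
  then have "n * (D - 1) \<le> 2 * ((n - card S) * (D - 1))"
    by (metis mult.assoc mult_le_mono1)
  also have "(n - card S) * (D - 1) = (\<Sum>v\<in>{..<n} - S. D - 1)"
    using Sn by (simp add: card_Diff_subset finite_subset[OF Sn])
  also have "\<dots> \<le> (\<Sum>v\<in>{..<n} - S. ?d v)"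
    by (intro sum_mono) (auto simp: S_def)
  also have "\<dots> \<le> (\<Sum>v<n. ?d v)" by (intro sum_mono2) auto
  also have "\<dots> = 2 * card E" using sum_degrees E by blast
  finally have "n * (D - 1) \<le> 4 * card E" by simp
  then have "n * (D - 1) \<le> 4 * r * count_cycles E r" using E by simp
  then show ?thesis using E by blast
qed

section \<open>The extremal number and its asymptotics\<close>

text \<open>Finiteness gives \<open>Max\<close> in \<open>ex_cycles\<close> its intended
  meaning.\<close>

lemma finite_cycle_counts:
  "finite {count_cycles E h | E. simple_graph n E \<and> (\<forall>k\<in>F. \<not> contains_cycle E k)}"
proof -
  have "finite {E. simple_graph n E}"
    by (rule finite_subset[of _ "Pow (Pow {..<n})"]) (auto simp: simple_graph_def)
  then show ?thesis by simp
qed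

lemma ex_cycles_le:
  assumes "\<And>E. simple_graph n E \<Longrightarrow> (\<forall>k\<in>F. \<not> contains_cycle E k) \<Longrightarrow> count_cycles E h \<le> b"
  shows "ex_cycles n h F \<le> b"
  unfolding ex_cycles_def
proof (rule Max.boundedI[OF finite_cycle_counts])
  have "simple_graph n {} \<and> (\<forall>k\<in>F. \<not> contains_cycle {} k)"
    by (auto simp: simple_graph_def not_contains_cycle_empty)
  then show "{count_cycles E h | E. simple_graph n E \<and> (\<forall>k\<in>F. \<not> contains_cycle E k)} \<noteq> {}" by blast
qed (use assms in auto)

lemma count_cycles_le_ex_cycles:
  assumes "simple_graph n E" "\<forall>k\<in>F. \<not> contains_cycle E k"
  shows "count_cycles E h \<le> ex_cycles n h F"
  unfolding ex_cycles_def using assms by (intro Max_ge[OF finite_cycle_counts]) auto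

lemma ex_cycles_lower_bound:
  assumes "3 \<le> r" "F \<subseteq> {..M}" "r \<notin> F" "1 \<le> M"
    and n: "(16 * real r) ^ (M + 1) \<le> real n"
  shows "real n powr (1 + 1 / real (M + 1)) \<le> 32 * real r ^ 2 * real (ex_cycles n r F)"
proof -
  define x where "x = real n powr (1 / real (M + 1))"
  have r: "real r \<ge> 3" using assms(1) by simp
  have npos: "real n > 0" using n r by (meson less_le_trans mult_pos_pos zero_less_numeral zero_less_power less_le_trans)
  have x16: "16 * real r \<le> x"
  proof -
    define y where "y = 16 * real r"
    have "y = (y ^ (M + 1)) powr (1 / real (M + 1))"
      using r unfolding y_def[symmetric]
      by (subst powr_realpow[symmetric]) (auto simp: y_def powr_powr)
    then have "16 * real r = ((16 * real r) ^ (M + 1)) powr (1 / real (M + 1))"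
      unfolding y_def .
    also have "\<dots> \<le> x" unfolding x_def using n r by (intro powr_mono2) auto
    finally show ?thesis .
  qed
  then have x1: "1 \<le> x" and xpos: "0 < x" using r by auto
  have xn: "x ^ (M + 1) = real n"
    unfolding x_def using npos by (simp add: powr_realpow[symmetric] powr_powr del: power_Suc)
  \<comment> \<open>Here \<open>x\<close> is the root of order \<open>M + 1\<close> of
    \<open>n\<close>. The bound \<open>4\<close> on \<open>x / (4 * real r)\<close> absorbs the
    rounding: \<open>D + 1\<close> is at most \<open>x / (2 * real r)\<close> and
    \<open>D - 1\<close> at least \<open>x / (8 * real r)\<close>.\<close>
  define D where "D = nat \<lfloor>x / (4 * real r)\<rfloor>"
  have q: "4 \<le> x / (4 * real r)" using x16 r by (simp add: field_simps)
  have D: "real D \<le> x / (4 * real r)" "x / (4 * real r) < real D + 1"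
    using q unfolding D_def by linarith+
  have "2 * r * (D + 1) ^ M \<le> n"
  proof -
    have "real D + 1 \<le> x / (2 * real r)" using D(1) q r by (simp add: field_simps)
    then have "2 * real r * (real D + 1) ^ M \<le> 2 * real r * (x / (2 * real r)) ^ M"
      using r by (intro mult_left_mono power_mono) auto
    also have "\<dots> \<le> 2 * real r * (x ^ M / (2 * real r))"
    proof -
      have "(2 * real r) ^ 1 \<le> (2 * real r) ^ M" using r assms(4) by (intro power_increasing) auto
      then show ?thesis
        using r xpos by (intro mult_left_mono) (auto simp: power_divide intro!: divide_left_mono)
    qed
    also have "\<dots> = x ^ M" using r by simp
    also have "\<dots> \<le> x ^ (M + 1)" using x1 by (intro power_increasing) auto
    finally have "real (2 * r * (D + 1) ^ M) \<le> real n" using xn by (simp add: add.commute)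
    then show ?thesis by linarith
  qed
  then obtain E where E: "simple_graph n E" "\<forall>j\<in>F. \<not> contains_cycle E j"
    "n * (D - 1) \<le> 4 * r * count_cycles E r"
    using exists_graph_with_many_cycles[OF assms(1-4)] by blast
  have "n * (D - 1) \<le> 4 * r * ex_cycles n r F"
    using E(3) count_cycles_le_ex_cycles[OF E(1,2), of r] by (meson mult_le_mono2 order_trans)
  then have "real (n * (D - 1)) \<le> real (4 * r * ex_cycles n r F)" by linarith
  moreover have "x / (8 * real r) \<le> real (D - 1)"
  proof -
    have "x / (8 * real r) = x / (4 * real r) / 2" by simp
    then have "x / (8 * real r) \<le> real D - 1" using D(2) q by linarith
    then show ?thesis by linarith
  qed
  then have "real n * (x / (8 * real r)) \<le> real n * real (D - 1)" by (intro mult_left_mono) auto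
  ultimately have "real n * (x / (8 * real r)) \<le> 4 * real r * real (ex_cycles n r F)" by simp
  then have "real n * x \<le> 32 * real r ^ 2 * real (ex_cycles n r F)"
    using r by (simp add: field_simps power2_eq_square)
  then show ?thesis unfolding x_def using npos by (simp add: powr_add)
qed

theorem theorem14:
  fixes k l :: nat
  assumes "2 \<le> l" and "l < k"
  shows "(\<lambda>n. real (ex_cycles n (2*l+1) ({3..2*l} \<union> {2*k+1})))
            \<in> \<Omega>(\<lambda>n. real n powr (1 + 1 / (2 * real k + 2)))
       \<and> (\<lambda>n. real (ex_cycles n (2*l+1) ({3..2*l} \<union> {2*k+1})))
            \<in> O(\<lambda>n. real n ^ 2)"
proof
  \<comment> \<open>\<open>?M\<close> is the longest forbidden length, and \<open>?M + 1\<close>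
    gives the \<open>2k + 2\<close> of the exponent.\<close>
  let ?r = "2*l+1" and ?F = "{3..2*l} \<union> {2*k+1}" and ?M = "2*k+1"
  have "real n powr (1 + 1 / (2 * real k + 2)) \<le> 32 * real ?r ^ 2 * real (ex_cycles n ?r ?F)"
    if "(16 * real ?r) ^ (?M + 1) \<le> real n" for n
  proof -
    have "real n powr (1 + 1 / real (?M + 1)) \<le> 32 * real ?r ^ 2 * real (ex_cycles n ?r ?F)"
      by (rule ex_cycles_lower_bound[OF _ _ _ _ that]) (use assms in auto)
    moreover have "real (?M + 1) = 2 * real k + 2" by simp
    ultimately show ?thesis by metis
  qed
  then have "\<forall>\<^sub>F n in sequentially. norm (real n powr (1 + 1 / (2 * real k + 2)))
      \<le> 32 * real ?r ^ 2 * norm (real (ex_cycles n ?r ?F))"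
    using eventually_ge_at_top[of "nat \<lceil>(16 * real ?r) ^ (?M + 1)\<rceil>"]
    by (auto elim!: eventually_mono simp: nat_le_iff ceiling_le_iff)
  then show "(\<lambda>n. real (ex_cycles n ?r ?F)) \<in> \<Omega>(\<lambda>n. real n powr (1 + 1 / (2 * real k + 2)))"
    unfolding bigomega_iff_bigo by (rule bigoI)
next
  \<comment> \<open>\<open>?m\<close> is the odd number of edges that two geodesics with
    \<open>l\<close> edges each need to complete a cycle of length \<open>2*k+1\<close>.\<close>
  let ?r = "2*l+1" and ?F = "{3..2*l} \<union> {2*k+1}" and ?m = "2 * (k - l) + 1"
  have m: "2 * l + ?m = 2 * k + 1" using assms by simp
  have "ex_cycles n ?r ?F \<le> (?m + 2) * n ^ 2" for n
    by (rule ex_cycles_le, rule count_odd_cycles_le) (use assms m in auto)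
  then have "real (ex_cycles n ?r ?F) \<le> real (?m + 2) * real n ^ 2" for n
    by (metis of_nat_mono of_nat_mult of_nat_power)
  then show "(\<lambda>n. real (ex_cycles n ?r ?F)) \<in> O(\<lambda>n. real n ^ 2)"
    by (intro bigoI[where c = "real (?m + 2)"] always_eventually allI)
      simp
qed

end
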